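(* The subspace of finitely discriminable groups is dense in the space of finitely generated groups; that is, for every $m\ge 1$, the set of points $N\in\mathcal{G}_m$ such that $F_m/N$ is finitely discriminable is dense in $\mathcal{G}_m$.
   Context: $F_m$ is the free group of rank $m$, and $\mathcal{G}_m$ is the set of normal subgroups of $F_m$ with the topology induced by the product topology on $\{0,1\}^{F_m}$; a point $N$ represents the marked group $F_m/N$. A group $G$ is finitely discriminable if there exists a finite subset $F\subset G-\{1\}$ such that every non-trivial normal subgroup of $G$ contains at least one element of $F$. *)

theory Defs
  imports "HOL-Algebra.Coset" "HOL-Analysis.Function_Topology"
begin

section \<open>Free groups of finite rank\<close>

text \<open>
  The free group of rank \<open>m\<close> is realised by reduced words. The letter \<open>(i, True)\<close> is the
  generator \<open>x\<^sub>i\<close> and \<open>(i, False)\<close> is its inverse.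
\<close>

type_synonym letter = "nat \<times> bool"

definition flip :: "letter \<Rightarrow> letter" where
  "flip x = (fst x, \<not> snd x)"

definition reduced :: "letter list \<Rightarrow> bool" where
  "reduced = successively (\<lambda>x y. y \<noteq> flip x)"

fun lmult :: "letter \<Rightarrow> letter list \<Rightarrow> letter list" where
  "lmult x [] = [x]"
| "lmult x (y # ys) = (if y = flip x then ys else x # y # ys)"

text \<open>For reduced \<open>u\<close> and \<open>v\<close>, \<open>foldr lmult u v\<close> is the reduced form of \<open>u @ v\<close>.\<close>

definition free_group :: "nat \<Rightarrow> letter list monoid" where
  "free_group m =
    \<lparr>carrier = {w. reduced w \<and> set w \<subseteq> {..<m} \<times> UNIV},
     mult = (\<lambda>u v. foldr lmult u v),
     one = []\<rparr>"

lemma flip_flip [simp]: "flip (flip x) = x"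
  by (simp add: flip_def)

lemma flip_neq [simp]: "flip x \<noteq> x" "x \<noteq> flip x"
  by (auto simp: flip_def prod_eq_iff)

lemma reduced_Nil [simp]: "reduced []"
  and reduced_Cons: "reduced (x # xs) \<longleftrightarrow> reduced xs \<and> (xs = [] \<or> hd xs \<noteq> flip x)"
  by (auto simp: reduced_def successively_Cons)

lemma reduced_lmult: "reduced w \<Longrightarrow> reduced (lmult x w)"
  by (cases w) (auto simp: reduced_Cons)

lemma reduced_foldr: "reduced w \<Longrightarrow> reduced (foldr lmult u w)"
  by (induction u) (auto intro: reduced_lmult)

lemma set_lmult: "set (lmult x w) \<subseteq> insert x (set w)"
  by (cases w) auto

lemma set_foldr_lmult: "set (foldr lmult u w) \<subseteq> set u \<union> set w"
proof (induction u)
  case (Cons x u)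
  then show ?case using set_lmult[of x "foldr lmult u w"] by auto
qed simp

lemma lmult_flip: "reduced w \<Longrightarrow> lmult x (lmult (flip x) w) = w"
proof (cases w)
  case (Cons y ys)
  assume "reduced w"
  then show ?thesis using Cons by (cases ys) (auto simp: reduced_Cons)
qed simp

lemma foldr_lmult_lmult:
  assumes "reduced w"
  shows "foldr lmult (lmult x v) w = lmult x (foldr lmult v w)"
proof (cases v)
  case (Cons y ys)
  then show ?thesis
    using lmult_flip[OF reduced_foldr[OF assms], of x ys] by auto
qed simp

lemma foldr_lmult_assoc:
  "reduced w \<Longrightarrow> foldr lmult (foldr lmult u v) w = foldr lmult u (foldr lmult v w)"
  by (induction u) (auto simp: foldr_lmult_lmult)

lemma foldr_lmult_Nil: "reduced u \<Longrightarrow> foldr lmult u [] = u"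
proof (induction u)
  case (Cons x u)
  then show ?case by (cases u) (auto simp: reduced_Cons)
qed simp

lemma foldr_lmult_inverse:
  "reduced v \<Longrightarrow> foldr lmult (rev (map flip u)) (foldr lmult u v) = v"
proof (induction u arbitrary: v)
  case (Cons x u)
  have "lmult (flip x) (lmult x (foldr lmult u v)) = foldr lmult u v"
    using lmult_flip[of "foldr lmult u v" "flip x"] Cons.prems by (simp add: reduced_foldr)
  with Cons show ?case by simp
qed simp

lemma group_free_group: "group (free_group m)"
proof (rule groupI)
  fix u v assume "u \<in> carrier (free_group m)" "v \<in> carrier (free_group m)"
  then show "u \<otimes>\<^bsub>free_group m\<^esub> v \<in> carrier (free_group m)"
    using set_foldr_lmult[of u v] by (auto simp: free_group_def reduced_foldr)
next
  fix u assume u: "u \<in> carrier (free_group m)"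
  let ?v = "foldr lmult (rev (map flip u)) []"
  have "set ?v \<subseteq> flip ` set u"
    using set_foldr_lmult[of "rev (map flip u)" "[]"] by auto
  also have "\<dots> \<subseteq> {..<m} \<times> UNIV"
    using u by (auto simp: free_group_def flip_def)
  finally have "?v \<in> carrier (free_group m)"
    by (simp add: free_group_def reduced_foldr)
  moreover have "?v \<otimes>\<^bsub>free_group m\<^esub> u = \<one>\<^bsub>free_group m\<^esub>"
    using u foldr_lmult_inverse[of "[]" u]
    by (simp add: free_group_def foldr_lmult_assoc foldr_lmult_Nil)
  ultimately show "\<exists>v\<in>carrier (free_group m). v \<otimes>\<^bsub>free_group m\<^esub> u = \<one>\<^bsub>free_group m\<^esub>"
    by blast
qed (auto simp: free_group_def foldr_lmult_assoc)

text \<open>The universal property: any map from the generators to a group extends uniquely.\<close>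

definition letter_value :: "('a, 'b) monoid_scheme \<Rightarrow> (nat \<Rightarrow> 'a) \<Rightarrow> letter \<Rightarrow> 'a" where
  "letter_value G g x = (if snd x then g (fst x) else inv\<^bsub>G\<^esub> (g (fst x)))"

definition word_value :: "('a, 'b) monoid_scheme \<Rightarrow> (nat \<Rightarrow> 'a) \<Rightarrow> letter list \<Rightarrow> 'a" where
  "word_value G g w = foldr (\<lambda>x a. letter_value G g x \<otimes>\<^bsub>G\<^esub> a) w \<one>\<^bsub>G\<^esub>"

lemma free_group_extension_exists:
  assumes "group G" and g: "\<And>i. i < m \<Longrightarrow> g i \<in> carrier G"
  shows "word_value G g \<in> hom (free_group m) G"
    and "\<And>i. i < m \<Longrightarrow> word_value G g [(i, True)] = g i"
proof -
  interpret group G by fact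
  have lv: "letter_value G g x \<in> carrier G" if "x \<in> {..<m} \<times> UNIV" for x
    using that g by (auto simp: letter_value_def)
  have wv_Cons: "word_value G g (x # w) = letter_value G g x \<otimes>\<^bsub>G\<^esub> word_value G g w" for x w
    by (simp add: word_value_def)
  have wv: "word_value G g w \<in> carrier G" if "set w \<subseteq> {..<m} \<times> UNIV" for w
    using that by (induction w) (auto simp: wv_Cons lv, simp add: word_value_def)
  have cancel: "letter_value G g x \<otimes>\<^bsub>G\<^esub> (letter_value G g (flip x) \<otimes>\<^bsub>G\<^esub> a) = a"
    if "x \<in> {..<m} \<times> UNIV" "a \<in> carrier G" for x a
    using that g by (auto simp: letter_value_def flip_def m_assoc[symmetric])
  have lmult: "word_value G g (lmult x w) = letter_value G g x \<otimes>\<^bsub>G\<^esub> word_value G g w"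
    if "x \<in> {..<m} \<times> UNIV" "set w \<subseteq> {..<m} \<times> UNIV" for x w
    using that by (cases w) (auto simp: wv_Cons cancel wv)
  have "word_value G g (foldr lmult u v) = word_value G g u \<otimes>\<^bsub>G\<^esub> word_value G g v"
    if "set u \<subseteq> {..<m} \<times> UNIV" and v: "set v \<subseteq> {..<m} \<times> UNIV" for u v
    using that(1)
  proof (induction u)
    case Nil
    then show ?case using wv[OF v] by (simp add: word_value_def)
  next
    case (Cons x u)
    have "set (foldr lmult u v) \<subseteq> {..<m} \<times> UNIV"
      using set_foldr_lmult[of u v] Cons.prems v by auto
    then show ?case
      using Cons.prems Cons.IH v by (simp add: lmult wv_Cons lv wv m_assoc)
  qed
  then show "word_value G g \<in> hom (free_group m) G"
    by (auto simp: hom_def free_group_def intro: wv)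
  show "word_value G g [(i, True)] = g i" if "i < m" for i
    using that g by (simp add: word_value_def letter_value_def)
qed

lemma free_group_extension_unique:
  assumes "group G" and h: "h \<in> hom (free_group m) G" and k: "k \<in> hom (free_group m) G"
    and eq: "\<And>i. i < m \<Longrightarrow> h [(i, True)] = k [(i, True)]"
    and w: "w \<in> carrier (free_group m)"
  shows "h w = k w"
proof -
  interpret F: group "free_group m" by (rule group_free_group)
  interpret h: group_hom "free_group m" G h
    by (simp add: group_hom_def group_hom_axioms_def F.is_group assms)
  interpret k: group_hom "free_group m" G k
    by (simp add: group_hom_def group_hom_axioms_def F.is_group assms)
  have letter: "[x] \<in> carrier (free_group m) \<and> h [x] = k [x]" if x: "x \<in> {..<m} \<times> UNIV" for x
  proof -
    obtain i b where ib: "x = (i, b)" "i < m" using x by auto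
    have c: "[(i, c)] \<in> carrier (free_group m)" for c
      using ib by (simp add: free_group_def reduced_Cons)
    have "[(i, False)] \<otimes>\<^bsub>free_group m\<^esub> [(i, True)] = \<one>\<^bsub>free_group m\<^esub>"
      by (simp add: free_group_def flip_def)
    then have "[(i, False)] = inv\<^bsub>free_group m\<^esub> [(i, True)]"
      using c by (metis F.inv_equality)
    then have "h [(i, False)] = k [(i, False)]"
      using eq[OF ib(2)] c h.hom_inv[of "[(i, True)]"] k.hom_inv[of "[(i, True)]"] by simp
    then show ?thesis using eq[OF ib(2)] ib c by (cases b) auto
  qed
  show ?thesis using w
  proof (induction w)
    case Nil
    then show ?case using h.hom_one k.hom_one by (simp add: free_group_def)
  next
    case (Cons x w)
    then have x: "x \<in> {..<m} \<times> UNIV" and w: "w \<in> carrier (free_group m)"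
      by (auto simp: free_group_def reduced_Cons)
    have "x # w = [x] \<otimes>\<^bsub>free_group m\<^esub> w"
      using Cons.prems by (cases w) (auto simp: free_group_def reduced_Cons)
    then show ?case
      using Cons.IH[OF w] letter[OF x] w h.hom_mult k.hom_mult by metis
  qed
qed


section \<open>The space of marked groups\<close>

text \<open>
  A set of words is identified with its indicator function on the free group, which is a point
  of the product of copies of a discrete two-point space. The \<open>restrict\<close> is needed because
  \<open>product_topology\<close> lives on extensional functions.
\<close>

definition marked_groups :: "nat \<Rightarrow> letter list set topology" where
  "marked_groups m =
    pullback_topology {N. N \<lhd> free_group m}
      (\<lambda>N. restrict (\<lambda>w. w \<in> N) (carrier (free_group m)))
      (product_topology (\<lambda>_. discrete_topology (UNIV :: bool set)) (carrier (free_group m)))"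

lemma topspace_marked_groups: "topspace (marked_groups m) = {N. N \<lhd> free_group m}"
  by (auto simp: marked_groups_def topspace_pullback_topology)


section \<open>Finitely discriminable groups\<close>

definition finitely_discriminable :: "('a, 'b) monoid_scheme \<Rightarrow> bool" where
  "finitely_discriminable G \<longleftrightarrow>
    (\<exists>F. finite F \<and> F \<subseteq> carrier G - {\<one>\<^bsub>G\<^esub>} \<and>
         (\<forall>N. N \<lhd> G \<and> N \<noteq> {\<one>\<^bsub>G\<^esub>} \<longrightarrow> N \<inter> F \<noteq> {}))"

end

theory Submission
  imports Defs
begin

text \<open>
  Let \<open>G\<close> be the free group. A basic neighbourhood of a marked group \<open>G/N\<close> only prescribes which elements of a finite set \<open>E\<close>
  lie in the normal subgroup (\<open>marked_groups_open_finite_determination\<close>). Let \<open>B = E - N\<close> be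
  the elements that must survive in the quotient. By Zorn's lemma, \<open>N\<close> is contained in a normal
  subgroup \<open>M\<close> that is maximal among the normal subgroups disjoint from \<open>B\<close>
  (\<open>exists_maximal_normal_avoiding\<close>). Enlarging \<open>N\<close> to \<open>M\<close> keeps the elements of
  \<open>E \<inter> N\<close> inside and those of \<open>B\<close> outside, so \<open>M\<close> is still in the neighbourhood. By
  maximality every normal subgroup strictly larger than \<open>M\<close> meets \<open>B\<close>; read in the quotient,
  this says that the image of \<open>B\<close> finitely discriminates \<open>G/M\<close>
  (\<open>finitely_discriminable_quotient\<close>).
\<close>

text \<open>
  This makes Zorn's lemma applicable: each axiom of a normal subgroup involves at most two of its
  elements, and these lie in a common member of the chain.
\<close>

lemma (in group) normal_Union_chain:
  assumes "\<C> \<noteq> {}" and normal: "\<And>N. N \<in> \<C> \<Longrightarrow> N \<lhd> G"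
    and chain: "\<And>N N'. N \<in> \<C> \<Longrightarrow> N' \<in> \<C> \<Longrightarrow> N \<subseteq> N' \<or> N' \<subseteq> N"
  shows "\<Union>\<C> \<lhd> G"
proof (rule normal_invI)
  have sub: "subgroup N G" if "N \<in> \<C>" for N
    using normal[OF that] by (rule normal_imp_subgroup)
  show "subgroup (\<Union>\<C>) G"
  proof (rule subgroupI)
    show "\<Union>\<C> \<subseteq> carrier G"
      using subgroup.subset[OF sub] by blast
    show "\<Union>\<C> \<noteq> {}"
      using \<open>\<C> \<noteq> {}\<close> subgroup.one_closed[OF sub] by blast
    show "inv x \<in> \<Union>\<C>" if "x \<in> \<Union>\<C>" for x
      using that subgroup.m_inv_closed[OF sub] by blast
    show "x \<otimes> y \<in> \<Union>\<C>" if xy: "x \<in> \<Union>\<C>" "y \<in> \<Union>\<C>" for x y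
    proof -
      obtain N where "N \<in> \<C>" "x \<in> N" "y \<in> N"
        using xy chain by blast
      then show ?thesis
        using subgroup.m_closed[OF sub] by blast
    qed
  qed
  show "x \<otimes> h \<otimes> inv x \<in> \<Union>\<C>" if "x \<in> carrier G" "h \<in> \<Union>\<C>" for x h
    using that normal normal_inv_iff by blast
qed

lemma (in group) exists_maximal_normal_avoiding:
  assumes "N \<lhd> G" "N \<inter> B = {}"
  obtains M where "M \<lhd> G" "N \<subseteq> M" "M \<inter> B = {}"
    "\<And>L. L \<lhd> G \<Longrightarrow> M \<subset> L \<Longrightarrow> L \<inter> B \<noteq> {}"
proof -
  define \<A> where "\<A> = {M. M \<lhd> G \<and> N \<subseteq> M \<and> M \<inter> B = {}}"
  have "\<exists>M\<in>\<A>. \<forall>X\<in>\<A>. M \<subseteq> X \<longrightarrow> X = M"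
  proof (rule subset_Zorn_nonempty)
    show "\<A> \<noteq> {}"
      using assms by (auto simp: \<A>_def)
    show "\<Union>\<C> \<in> \<A>" if "\<C> \<noteq> {}" "subset.chain \<A> \<C>" for \<C>
    proof -
      have "\<C> \<subseteq> \<A>" and "\<And>X Y. X \<in> \<C> \<Longrightarrow> Y \<in> \<C> \<Longrightarrow> X \<subseteq> Y \<or> Y \<subseteq> X"
        using that(2) by (auto simp: subset_chain_def)
      then have "\<Union>\<C> \<lhd> G"
        using \<open>\<C> \<noteq> {}\<close> by (intro normal_Union_chain) (auto simp: \<A>_def)
      then show ?thesis
        using \<open>\<C> \<noteq> {}\<close> \<open>\<C> \<subseteq> \<A>\<close> by (auto simp: \<A>_def)
    qed
  qed
  then obtain M where "M \<in> \<A>" and max: "\<And>X. X \<in> \<A> \<Longrightarrow> M \<subseteq> X \<Longrightarrow> X = M"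
    by blast
  show thesis
  proof (rule that)
    show "M \<lhd> G" "N \<subseteq> M" "M \<inter> B = {}"
      using \<open>M \<in> \<A>\<close> by (auto simp: \<A>_def)
    then show "L \<inter> B \<noteq> {}" if "L \<lhd> G" "M \<subset> L" for L
      using that max[of L] by (auto simp: \<A>_def)
  qed
qed

text \<open>
  Nontrivial normal subgroups of \<open>G/H\<close> correspond to normal subgroups of \<open>G\<close> strictly
  containing \<open>H\<close>: the preimage of a set \<open>K\<close> of cosets is \<open>\<Union>K\<close>. The image of \<open>B\<close> is a set of
  nontrivial cosets because \<open>H\<close> avoids \<open>B\<close>.
\<close>

lemma (in normal) finitely_discriminable_quotient:
  assumes "finite B" "B \<subseteq> carrier G" "H \<inter> B = {}"
    and meets: "\<And>L. L \<lhd> G \<Longrightarrow> H \<subset> L \<Longrightarrow> L \<inter> B \<noteq> {}"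
  shows "finitely_discriminable (G Mod H)"
  unfolding finitely_discriminable_def
proof (intro exI conjI allI impI)
  show "finite ((\<lambda>b. H #> b) ` B)"
    using \<open>finite B\<close> by simp
  show "(\<lambda>b. H #> b) ` B \<subseteq> carrier (G Mod H) - {\<one>\<^bsub>G Mod H\<^esub>}"
    using assms(2,3) coset_join1[OF _ _ is_subgroup]
    by (auto simp: FactGroup_def RCOSETS_def)
next
  fix K
  assume K: "K \<lhd> G Mod H \<and> K \<noteq> {\<one>\<^bsub>G Mod H\<^esub>}"
  then have sub: "subgroup K (G Mod H)"
    by (simp add: normal_imp_subgroup)
  have preimage: "\<Union>K = {x \<in> carrier G. H #> x \<in> K}"
    using sub by (rule factgroup_subgroup_union_char)
  have "H \<in> K"
    using subgroup.one_closed[OF sub] by simp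
  with K obtain C where "C \<in> K" "C \<noteq> H"
    by auto
  then obtain x where x: "x \<in> carrier G" "C = H #> x"
    using subgroup.subset[OF sub] by (auto simp: FactGroup_def RCOSETS_def)
  then have "x \<notin> H"
    using \<open>C \<noteq> H\<close> coset_join2[OF _ is_subgroup] by auto
  moreover have "x \<in> \<Union>K"
    using x \<open>C \<in> K\<close> by (simp add: preimage)
  ultimately have "H \<subset> \<Union>K"
    using \<open>H \<in> K\<close> by blast
  moreover have "\<Union>K \<lhd> G"
    using K by (simp add: factgroup_subgroup_union_normal)
  ultimately have "\<Union>K \<inter> B \<noteq> {}"
    by (intro meets)
  then show "K \<inter> (\<lambda>b. H #> b) ` B \<noteq> {}"
    by (auto simp: preimage)
qed

text \<open>
  A basic open set of the product constrains only finitely many coordinates, and the coordinate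
  of a normal subgroup at \<open>w\<close> records whether it contains \<open>w\<close>.
\<close>

lemma marked_groups_open_finite_determination:
  assumes "openin (marked_groups m) T" "N \<in> T"
  obtains E where "finite E" "E \<subseteq> carrier (free_group m)"
    "\<And>M. M \<lhd> free_group m \<Longrightarrow> M \<inter> E = N \<inter> E \<Longrightarrow> M \<in> T"
proof -
  define C where "C = carrier (free_group m)"
  define ind where "ind = (\<lambda>N. restrict (\<lambda>w. w \<in> N) C)"
  obtain U where U: "openin (product_topology (\<lambda>_. discrete_topology (UNIV :: bool set)) C) U"
    and T: "T = ind -` U \<inter> {N. N \<lhd> free_group m}"
    using assms(1) by (auto simp: marked_groups_def openin_pullback_topology C_def ind_def)
  then have "ind N \<in> U"
    using \<open>N \<in> T\<close> by simp
  with U obtain V where fin: "finite {w \<in> C. V w \<noteq> UNIV}"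
    and V: "ind N \<in> Pi\<^sub>E C V" "Pi\<^sub>E C V \<subseteq> U"
    unfolding openin_product_topology_alt by fastforce
  show thesis
  proof (rule that[OF fin])
    show "{w \<in> C. V w \<noteq> UNIV} \<subseteq> carrier (free_group m)"
      by (auto simp: C_def)
    show "M \<in> T" if M: "M \<lhd> free_group m"
      and eq: "M \<inter> {w \<in> C. V w \<noteq> UNIV} = N \<inter> {w \<in> C. V w \<noteq> UNIV}" for M
    proof -
      have "(w \<in> M) \<in> V w" if "w \<in> C" for w
      proof (cases "V w = UNIV")
        case False
        then have "w \<in> M \<longleftrightarrow> w \<in> N"
          using eq that by blast
        then show ?thesis
          using V(1) that by (auto simp: ind_def PiE_iff)
      qed simp
      then have "ind M \<in> Pi\<^sub>E C V"
        by (auto simp: ind_def)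
      then show ?thesis
        using V(2) M by (auto simp: T)
    qed
  qed
qed

theorem proposition3:
  fixes m :: nat
  assumes "m \<ge> 1"
  shows "marked_groups m closure_of
           {N. N \<lhd> free_group m \<and> finitely_discriminable (free_group m Mod N)}
         = topspace (marked_groups m)"
proof (rule subset_antisym[OF closure_of_subset_topspace], rule subsetI)
  interpret F: group "free_group m"
    by (rule group_free_group)
  fix N
  assume N: "N \<in> topspace (marked_groups m)"
  have "\<exists>M. M \<in> {N. N \<lhd> free_group m \<and> finitely_discriminable (free_group m Mod N)} \<and> M \<in> T"
    if T: "N \<in> T \<and> openin (marked_groups m) T" for T
  proof -
    obtain E where E: "finite E" "E \<subseteq> carrier (free_group m)"
      and det: "\<And>M. M \<lhd> free_group m \<Longrightarrow> M \<inter> E = N \<inter> E \<Longrightarrow> M \<in> T"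
      using marked_groups_open_finite_determination[of m T N] T by metis
    have "N \<lhd> free_group m"
      using N by (simp add: topspace_marked_groups)
    moreover have "N \<inter> (E - N) = {}"
      by blast
    ultimately obtain M where M: "M \<lhd> free_group m" "N \<subseteq> M" "M \<inter> (E - N) = {}"
      and max: "\<And>L. L \<lhd> free_group m \<Longrightarrow> M \<subset> L \<Longrightarrow> L \<inter> (E - N) \<noteq> {}"
      using F.exists_maximal_normal_avoiding[of N "E - N"] by metis
    have "finitely_discriminable (free_group m Mod M)"
      using E M(3) max by (intro normal.finitely_discriminable_quotient[OF M(1), of "E - N"]) auto
    moreover have "M \<in> T"
      using M by (intro det) auto
    ultimately show ?thesis
      using M(1) by blast
  qed
  then show "N \<in> marked_groups m closure_of
      {N. N \<lhd> free_group m \<and> finitely_discriminable (free_group m Mod N)}"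
    using N unfolding in_closure_of by (intro conjI allI impI)
qed

end
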